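(* (a) Every loc-lattice $\mathcal{L}=(L,\le)$ is representable as a lattice of intervals. (b) A well-separated lattice is faithfully representable as a lattice of intervals if and only if it is a loc-lattice.
   Context: All lattices here have a least element $0$. An interval of a linearly ordered set $(X,\le)$ is a convex subset of $X$ (the empty set included); $co(X)$ is the set of all intervals of $(X,\le)$, and for $A\subseteq X$, $co(A)$ also denotes the convex hull of $A$ in $(X,\le)$. A lattice $(L,\le)$ with $0$ is representable as a lattice of intervals if there exist a linearly ordered set $(X,\le)$ and an order-embedding $f:(L,\le)\to(co(X),\subseteq)$ (i.e. $a\le b$ iff $f(a)\subseteq f(b)$) such that $f(0)=\emptyset$ and $f(a\wedge b)=f(a)\cap f(b)$ for all $a,b\in L$. If, moreover, $f(a\vee b)=co(f(a)\cup f(b))$ for all $a,b\in L$ (so that $L$ is isomorphic to a sublattice of the lattice of all intervals of $(X,\le)$), then $L$ is faithfully representable as a lattice of intervals. A lattice $(L,\le)$ is a loc-lattice if: (1) for every $a,b,c\in L$: $b\le a\vee c$ or $a\le b\vee c$ or $c\le a\vee b$; (2) if $a,b,x$ are pairwise incomparable elements of $L$ and $x\le a\vee b$, then $(a\vee x)\wedge(b\vee x)=x$; (3) if $a,b,x\in L$ satisfy $x\le a\vee b$, $a\wedge x\neq 0$ and $b\wedge x\neq 0$, then $(a\wedge x)\vee(b\wedge x)=x$. A filter of $L$ is a nonempty proper subset $F\subsetneq L$ that is upward closed and closed under $\wedge$. A semi-prime filter of $L$ is a (proper) filter $F$ such that for every $a,b\in L$ with $a\vee b\in F$, either $a\in F$,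 or $b\in F$, or there exists $c\in F$ with $c\le a\vee b$ and $c\neq(a\wedge c)\vee(b\wedge c)$. The lattice $L$ is well-separated if for every semi-prime filter $F$ of $L$ and every $x\in L\setminus F$ there exists $y\in F$ such that $x\not\ge y$. *)

theory Defs
  imports Main "HOL.Hull"
begin

section \<open>Intervals of a linearly ordered set\<close>

text \<open>
  A linearly ordered set is a carrier \<open>X\<close>, possibly empty, with a reflexive
  linear order \<open>r \<subseteq> X \<times> X\<close> in the sense of \<^const>\<open>linear_order_on\<close>.
  The convex hull of \<open>A \<subseteq> X\<close> is \<open>order_interval X r hull A\<close>.
\<close>

definition order_interval :: "'x set \<Rightarrow> 'x rel \<Rightarrow> 'x set \<Rightarrow> bool" where
  "order_interval X r A \<longleftrightarrow>
     A \<subseteq> X \<and> (\<forall>x\<in>A. \<forall>z\<in>A. \<forall>y\<in>X. (x, y) \<in> r \<and> (y, z) \<in> r \<longrightarrow> y \<in> A)"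

lemma order_interval_hull_eq:
  assumes "linear_order_on X r" and "A \<subseteq> X"
  shows "order_interval X r hull A = {y \<in> X. \<exists>x\<in>A. \<exists>z\<in>A. (x, y) \<in> r \<and> (y, z) \<in> r}"
    (is "_ = ?H")
proof (rule hull_unique)
  have tr: "trans r" and rf: "refl_on X r"
    using assms(1) by (auto simp: order_on_defs)
  show "A \<subseteq> ?H"
    using rf assms(2) by (auto simp: refl_on_def)
  show "order_interval X r ?H"
    unfolding order_interval_def using tr by (auto dest: transD)
  show "?H \<subseteq> t" if "A \<subseteq> t" "order_interval X r t" for t
    using that unfolding order_interval_def by blast
qed


section \<open>Representations by intervals\<close>

definition interval_representation ::
  "'x set \<Rightarrow> 'x rel \<Rightarrow> ('a::bounded_lattice_bot \<Rightarrow> 'x set) \<Rightarrow> bool" where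
  "interval_representation X r f \<longleftrightarrow>
     linear_order_on X r \<and>
     (\<forall>a. order_interval X r (f a)) \<and>
     (\<forall>a b. a \<le> b \<longleftrightarrow> f a \<subseteq> f b) \<and>
     f bot = {} \<and>
     (\<forall>a b. f (inf a b) = f a \<inter> f b)"

definition faithful_interval_representation ::
  "'x set \<Rightarrow> 'x rel \<Rightarrow> ('a::bounded_lattice_bot \<Rightarrow> 'x set) \<Rightarrow> bool" where
  "faithful_interval_representation X r f \<longleftrightarrow>
     interval_representation X r f \<and>
     (\<forall>a b. f (sup a b) = order_interval X r hull (f a \<union> f b))"

text \<open>
  HOL cannot quantify existentially over the type of points of \<open>X\<close>, so the points are
  taken from the type \<open>'a set\<close>.  This loses nothing: by the lemmas
  \<open>representableI\<close> and \<open>faithfully_representableI\<close> below, a (faithful) representation over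
  points of an arbitrary type gives one of this form, by keeping one point \<open>p\<close> for each of
  the sets \<open>{a. p \<in> f a}\<close>.
\<close>

definition representable :: "'a::bounded_lattice_bot itself \<Rightarrow> bool" where
  "representable (_ :: 'a itself) \<longleftrightarrow>
     (\<exists>(X :: 'a set set) r (f :: 'a \<Rightarrow> 'a set set). interval_representation X r f)"

definition faithfully_representable :: "'a::bounded_lattice_bot itself \<Rightarrow> bool" where
  "faithfully_representable (_ :: 'a itself) \<longleftrightarrow>
     (\<exists>(X :: 'a set set) r (f :: 'a \<Rightarrow> 'a set set). faithful_interval_representation X r f)"

lemma interval_representation_transfer:
  fixes X :: "'x set" and f :: "'a::bounded_lattice_bot \<Rightarrow> 'x set"
  assumes rep: "interval_representation X r f"
  obtains X' :: "'a set set" and r' and f' :: "'a \<Rightarrow> 'a set set"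
  where "interval_representation X' r' f'"
    and "faithful_interval_representation X r f \<Longrightarrow> faithful_interval_representation X' r' f'"
proof -
  define F where "F p = {a. p \<in> f a}" for p
  define g where "g = inv_into X F"
  define X' where "X' = F ` X"
  define r' where "r' = {(P, Q). P \<in> X' \<and> Q \<in> X' \<and> (g P, g Q) \<in> r}"
  define f' where "f' a = {P \<in> X'. a \<in> P}" for a
  from rep have lin: "linear_order_on X r" and int: "\<And>a. order_interval X r (f a)"
    and emb: "\<And>a b. a \<le> b \<longleftrightarrow> f a \<subseteq> f b" and bot: "f bot = {}"
    and meet: "\<And>a b. f (inf a b) = f a \<inter> f b"
    by (auto simp: interval_representation_def)
  have rf: "refl_on X r" and tr: "trans r" and an: "antisym r" and tot: "total_on X r"
    using lin by (auto simp: order_on_defs)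
  have fX: "f a \<subseteq> X" for a using int by (auto simp: order_interval_def)
  have conv: "y \<in> f a" if "x \<in> f a" "z \<in> f a" "y \<in> X" "(x, y) \<in> r" "(y, z) \<in> r" for x y z a
    using int[of a] that unfolding order_interval_def by blast
  have gX: "g P \<in> X" if "P \<in> X'" for P
    using that by (auto simp: g_def X'_def intro: inv_into_into)
  have Fg: "F (g P) = P" if "P \<in> X'" for P
    using that by (auto simp: g_def X'_def f_inv_into_f)
  have gf: "g P \<in> f a \<longleftrightarrow> a \<in> P" if "P \<in> X'" for P a
    using Fg[OF that] by (auto simp: F_def)
  have FX: "F p \<in> X'" if "p \<in> X" for p using that by (simp add: X'_def)
  have Ff: "F p \<in> f' a" if "p \<in> f a" for p a
    using that FX fX[of a] by (auto simp: f'_def F_def)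
  have lin': "linear_order_on X' r'"
    unfolding order_on_defs
  proof (intro conjI)
    show "r' \<subseteq> X' \<times> X'" by (auto simp: r'_def)
    show "refl_on X' r'" using rf gX by (auto simp: refl_on_def r'_def)
    show "trans r'" using tr by (auto simp: r'_def intro!: transI dest: transD)
    show "antisym r'"
    proof (rule antisymI)
      fix P Q assume "(P, Q) \<in> r'" "(Q, P) \<in> r'"
      then have "P \<in> X'" "Q \<in> X'" "g P = g Q" using an by (auto simp: r'_def dest: antisymD)
      then show "P = Q" using Fg by metis
    qed
    show "total_on X' r'"
    proof (rule total_onI)
      fix P Q assume PQ: "P \<in> X'" "Q \<in> X'" "P \<noteq> Q"
      then have "g P \<noteq> g Q" using Fg by metis
      then show "(P, Q) \<in> r' \<or> (Q, P) \<in> r'"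
        using PQ gX tot by (auto simp: r'_def total_on_def)
    qed
  qed
  have int': "order_interval X' r' (f' a)" for a
    unfolding order_interval_def
  proof (intro conjI ballI impI)
    show "f' a \<subseteq> X'" by (auto simp: f'_def)
    fix P Q R assume "P \<in> f' a" "R \<in> f' a" "Q \<in> X'" "(P, Q) \<in> r' \<and> (Q, R) \<in> r'"
    then show "Q \<in> f' a"
      using conv[of "g P" a "g R" "g Q"] gX by (auto simp: f'_def r'_def gf)
  qed
  have emb': "a \<le> b \<longleftrightarrow> f' a \<subseteq> f' b" for a b
  proof
    assume "a \<le> b"
    then show "f' a \<subseteq> f' b" using emb[of a b] gf by (auto simp: f'_def)
  next
    assume sub: "f' a \<subseteq> f' b"
    have "p \<in> f b" if "p \<in> f a" for p
      using Ff[OF that] sub by (auto simp: f'_def F_def)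
    then show "a \<le> b" using emb by blast
  qed
  have rep': "interval_representation X' r' f'"
    unfolding interval_representation_def
  proof (intro conjI allI)
    show "f' bot = {}" using bot gf by (auto simp: f'_def)
    show "f' (inf a b) = f' a \<inter> f' b" for a b
      using meet[of a b] gf by (auto simp: f'_def)
  qed (fact lin' int' emb')+
  moreover have "faithful_interval_representation X' r' f'"
    if "faithful_interval_representation X r f"
    unfolding faithful_interval_representation_def
  proof (intro conjI allI)
    fix a b
    have hull: "order_interval X r hull (f a \<union> f b) =
        {y \<in> X. \<exists>x\<in>f a \<union> f b. \<exists>z\<in>f a \<union> f b. (x, y) \<in> r \<and> (y, z) \<in> r}"
      by (rule order_interval_hull_eq) (use lin fX in auto)
    have hull': "order_interval X' r' hull (f' a \<union> f' b) =
        {y \<in> X'. \<exists>x\<in>f' a \<union> f' b. \<exists>z\<in>f' a \<union> f' b. (x, y) \<in> r' \<and> (y, z) \<in> r'}"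
      by (rule order_interval_hull_eq) (use lin' in \<open>auto simp: f'_def\<close>)
    have join: "f (sup a b) = order_interval X r hull (f a \<union> f b)"
      using that by (simp add: faithful_interval_representation_def)
    have dich: "(p, q) \<in> r \<or> (q, p) \<in> r" if "p \<in> X" "q \<in> X" for p q
      using that rf tot by (metis refl_on_def total_on_def)
    have below: "(g (F x), q) \<in> r" if "x \<in> f c" "q \<in> X" "(x, q) \<in> r" "q \<notin> f c" for x q c
    proof (rule ccontr)
      assume n: "(g (F x), q) \<notin> r"
      have "F x \<in> X'" "c \<in> F x" using that fX FX by (auto simp: F_def)
      then have "g (F x) \<in> f c" "g (F x) \<in> X" using gf gX by auto
      with n that dich conv show False by blast
    qed
    have above: "(q, g (F x)) \<in> r" if "x \<in> f c" "q \<in> X" "(q, x) \<in> r" "q \<notin> f c" for x q c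
    proof (rule ccontr)
      assume n: "(q, g (F x)) \<notin> r"
      have "F x \<in> X'" "c \<in> F x" using that fX FX by (auto simp: F_def)
      then have "g (F x) \<in> f c" "g (F x) \<in> X" using gf gX by auto
      with n that dich conv show False by blast
    qed
    show "f' (sup a b) = order_interval X' r' hull (f' a \<union> f' b)"
    proof (intro subset_antisym subsetI)
      fix P assume "P \<in> f' (sup a b)"
      then have P: "P \<in> X'" "g P \<in> f (sup a b)" using gf by (auto simp: f'_def)
      show "P \<in> order_interval X' r' hull (f' a \<union> f' b)"
      proof (cases "P \<in> f' a \<union> f' b")
        case True
        then show ?thesis using hull_subset[of "f' a \<union> f' b" "order_interval X' r'"] by blast
      next
        case False
        then have n: "g P \<notin> f a" "g P \<notin> f b" using P gf by (auto simp: f'_def)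
        from P obtain x z where xz: "x \<in> f a \<union> f b" "z \<in> f a \<union> f b" "(x, g P) \<in> r" "(g P, z) \<in> r"
          using join hull by auto
        have "(g (F x), g P) \<in> r" "(g P, g (F z)) \<in> r"
          using xz n below above gX[OF P(1)] by blast+
        moreover have "F x \<in> f' a \<union> f' b" "F z \<in> f' a \<union> f' b" using xz Ff by blast+
        ultimately show ?thesis
          unfolding hull' using P(1) by (auto simp: r'_def f'_def)
      qed
    next
      fix P assume "P \<in> order_interval X' r' hull (f' a \<union> f' b)"
      then obtain Q R where "P \<in> X'" and QR: "Q \<in> f' a \<union> f' b" "R \<in> f' a \<union> f' b"
        "(Q, P) \<in> r'" "(P, R) \<in> r'"
        unfolding hull' by blast
      moreover have "g Q \<in> f a \<union> f b" "g R \<in> f a \<union> f b"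
        using QR gf by (auto simp: f'_def)
      moreover have "(g Q, g P) \<in> r" "(g P, g R) \<in> r" using QR by (auto simp: r'_def)
      ultimately have "g P \<in> f (sup a b)"
        unfolding join hull using gX by blast
      then show "P \<in> f' (sup a b)" using gf \<open>P \<in> X'\<close> by (auto simp: f'_def)
    qed
  qed (fact rep')
  ultimately show ?thesis using that by blast
qed

lemma representableI:
  fixes X :: "'x set" and f :: "'a::bounded_lattice_bot \<Rightarrow> 'x set"
  assumes "interval_representation X r f"
  shows "representable TYPE('a)"
  using interval_representation_transfer[OF assms] unfolding representable_def by metis

lemma faithfully_representableI:
  fixes X :: "'x set" and f :: "'a::bounded_lattice_bot \<Rightarrow> 'x set"
  assumes "faithful_interval_representation X r f"
  shows "faithfully_representable TYPE('a)"
proof -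
  have "interval_representation X r f"
    using assms by (simp add: faithful_interval_representation_def)
  from interval_representation_transfer[OF this] assms show ?thesis
    unfolding faithfully_representable_def by metis
qed


section \<open>Loc-lattices\<close>

definition incomparable :: "'a::order \<Rightarrow> 'a \<Rightarrow> bool" where
  "incomparable a b \<longleftrightarrow> \<not> a \<le> b \<and> \<not> b \<le> a"

definition loc_lattice :: "'a::bounded_lattice_bot itself \<Rightarrow> bool" where
  "loc_lattice (_ :: 'a itself) \<longleftrightarrow>
     (\<forall>a b c :: 'a. b \<le> sup a c \<or> a \<le> sup b c \<or> c \<le> sup a b) \<and>
     (\<forall>a b x :: 'a. incomparable a b \<and> incomparable a x \<and> incomparable b x \<and> x \<le> sup a b \<longrightarrow>
        inf (sup a x) (sup b x) = x) \<and>
     (\<forall>a b x :: 'a. x \<le> sup a b \<and> inf a x \<noteq> bot \<and> inf b x \<noteq> bot \<longrightarrow>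
        sup (inf a x) (inf b x) = x)"


section \<open>Semi-prime filters and well-separated lattices\<close>

definition proper_lattice_filter :: "'a::bounded_lattice_bot set \<Rightarrow> bool" where
  "proper_lattice_filter F \<longleftrightarrow>
     F \<noteq> {} \<and> F \<noteq> UNIV \<and>
     (\<forall>a b. a \<in> F \<and> a \<le> b \<longrightarrow> b \<in> F) \<and>
     (\<forall>a b. a \<in> F \<and> b \<in> F \<longrightarrow> inf a b \<in> F)"

definition semi_prime_filter :: "'a::bounded_lattice_bot set \<Rightarrow> bool" where
  "semi_prime_filter F \<longleftrightarrow>
     proper_lattice_filter F \<and>
     (\<forall>a b. sup a b \<in> F \<longrightarrow>
        a \<in> F \<or> b \<in> F \<or> (\<exists>c\<in>F. c \<le> sup a b \<and> c \<noteq> sup (inf a c) (inf b c)))"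

text \<open>
  The following is the literal definition.  Since \<open>F\<close> is nonempty and upward closed, the
  condition on \<open>x \<notin> F\<close> is met by every \<open>y \<in> F\<close>.
\<close>

definition well_separated :: "'a::bounded_lattice_bot itself \<Rightarrow> bool" where
  "well_separated (_ :: 'a itself) \<longleftrightarrow>
     (\<forall>F :: 'a set. semi_prime_filter F \<longrightarrow> (\<forall>x. x \<notin> F \<longrightarrow> (\<exists>y\<in>F. \<not> x \<ge> y)))"

end

theory Submission
  imports Defs
begin

text \<open>
  The points of the representing linear order are the semi-prime filters of the lattice, and an
  element \<open>a\<close> is represented by the set of the semi-prime filters that contain it.  A filter
  that is maximal among those containing \<open>y\<close> and omitting \<open>x\<close> is semi-prime, so there are
  enough points to make this an order-embedding.  What has to be found is the linear order.

  In a lattice of intervals, two incomparable intervals have distinct left ends and distinct right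
  ends, ordered the same way, so one of them lies to the left of the other.  If \<open>a\<close> and \<open>c\<close> are both
  incomparable to \<open>b\<close>, they lie on opposite sides of \<open>b\<close> exactly when \<open>b \<le> sup a c\<close>.  The first two
  axioms of a loc-lattice show that this splits the elements incomparable to \<open>b\<close> into at most two
  sides (\<open>same_side_parity\<close>).  The sides at different elements can be labelled ``left'' and ``right''
  coherently provided that one cannot walk through incomparable elements, keeping track of the
  direction, and come back with the direction reversed.  This is \<open>no_odd_closed_walk\<close>: a shortest
  counterexample has no short chords, which is impossible at a minimal element of the walk.  One arbitrary
  choice of direction in each connected component of the incomparability graph then
  determines an orientation (\<open>loc_lattice_orientation\<close>).

  The same pattern recurs at a semi-prime filter \<open>F\<close>: nonzero elements \<open>a\<close> and \<open>c\<close> outside \<open>F\<close> lie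
  on opposite sides of the point \<open>F\<close> exactly when \<open>sup a c \<in> F\<close>, and there are at most two sides
  (\<open>join_notin_parity\<close>).  The orientation tells which of them is the left one, and a filter
  \<open>F\<close> precedes \<open>G\<close> if some member of \<open>F\<close> lies to the left of \<open>G\<close> or some member of \<open>G\<close> to the right of
  \<open>F\<close>.  This is a linear order, and joins are sent to convex hulls because two elements outside
  \<open>F\<close> whose join is in \<open>F\<close> lie on opposite sides of \<open>F\<close>.

  That every lattice of intervals is a loc-lattice is a direct argument about end points
  (\<open>faithfully_representable_loc_lattice\<close>).
\<close>

section \<open>Sides of an element\<close>

text \<open>
  Meant for \<open>a\<close> and \<open>c\<close> incomparable to \<open>b\<close>: in a lattice of intervals the hull of \<open>a\<close> and \<open>c\<close>
  covers \<open>b\<close> precisely when one of them reaches beyond the left end of \<open>b\<close> and the other beyond the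
  right end.
\<close>

definition same_side :: "'a::bounded_lattice_bot \<Rightarrow> 'a \<Rightarrow> 'a \<Rightarrow> bool" where
  "same_side b a c \<longleftrightarrow> \<not> b \<le> sup a c"

lemma incomparable_sym: "incomparable a b \<longleftrightarrow> incomparable b a"
  by (auto simp: incomparable_def)

lemma same_side_sym: "same_side b a c \<longleftrightarrow> same_side b c a"
  by (simp add: same_side_def sup_commute)

lemma same_side_refl: "incomparable a b \<Longrightarrow> same_side b a a"
  by (simp add: same_side_def incomparable_def)

lemma same_side_if_comparable:
  assumes "incomparable a b" "incomparable c b" "\<not> incomparable a c"
  shows "same_side b a c"
  using assms by (auto simp: same_side_def incomparable_def sup_absorb1 sup_absorb2)

lemma loc_lattice_one_below_join:
  fixes a b c :: "'a::bounded_lattice_bot"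
  assumes "loc_lattice TYPE('a)"
  shows "a \<le> sup b c \<or> b \<le> sup a c \<or> c \<le> sup a b"
  using assms unfolding loc_lattice_def by blast

lemma loc_lattice_middle:
  fixes a b x :: "'a::bounded_lattice_bot"
  assumes "loc_lattice TYPE('a)"
    and "incomparable a b" "incomparable a x" "incomparable b x" "x \<le> sup a b"
  shows "inf (sup a x) (sup b x) = x"
  using assms unfolding loc_lattice_def by blast

lemma loc_lattice_split:
  fixes a b x :: "'a::bounded_lattice_bot"
  assumes "loc_lattice TYPE('a)" "x \<le> sup a b" "x \<noteq> sup (inf a x) (inf b x)"
  shows "inf a x = bot \<or> inf b x = bot"
  using assms unfolding loc_lattice_def by metis

lemma incomparable_sup:
  fixes a b c :: "'a::bounded_lattice_bot"
  assumes "incomparable a b" "\<not> b \<le> sup a c"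
  shows "incomparable (sup a c) b"
  using assms order_trans[OF sup_ge1, of a c b] unfolding incomparable_def by blast

text \<open>
  If \<open>b\<close> were between \<open>a\<close> and \<open>d\<close> only, then it would also be between \<open>sup a c\<close> and \<open>sup d c\<close>.  The
  second axiom then bounds what these two joins share by \<open>b\<close>, but they share \<open>c\<close>.
\<close>

lemma same_side_trans:
  fixes a b c d :: "'a::bounded_lattice_bot"
  assumes loc: "loc_lattice TYPE('a)"
    and inc: "incomparable a b" "incomparable c b" "incomparable d b"
    and ss: "same_side b a c" "same_side b c d"
  shows "same_side b a d"
proof (rule ccontr)
  assume "\<not> same_side b a d"
  then have le: "b \<le> sup a d" by (simp add: same_side_def)
  have n: "\<not> b \<le> sup a c" "\<not> b \<le> sup d c"
    using ss by (simp_all add: same_side_def sup_commute)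
  have i1: "incomparable (sup a c) b" and i2: "incomparable (sup d c) b"
    using incomparable_sup inc n by blast+
  have i3: "incomparable (sup a c) (sup d c)"
  proof (rule ccontr)
    assume "\<not> ?thesis"
    then have "sup a d \<le> sup d c \<or> sup a d \<le> sup a c"
      unfolding incomparable_def by (auto intro: order_trans[OF sup_ge1] order_trans[OF sup_ge2])
    then show False using n le order_trans by blast
  qed
  have "b \<le> sup (sup a c) (sup d c)"
    using le by (rule order_trans) (simp add: le_supI1 le_supI2)
  have "c \<le> inf (sup (sup a c) b) (sup (sup d c) b)"
    by (simp add: le_supI1)
  also have "\<dots> = b"
    by (rule loc_lattice_middle[OF loc i3 i1 i2]) fact
  finally show False using inc by (simp add: incomparable_def)
qed

text \<open>
  There are no three sides.  If \<open>b\<close> were between any two of \<open>a\<close>, \<open>c\<close> and \<open>d\<close>, then for the middle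
  one of these three, say \<open>c\<close>, the second axiom gives \<open>b \<le> inf (sup a c) (sup d c) = c\<close>.
\<close>

lemma opposite_sides:
  fixes a b c d :: "'a::bounded_lattice_bot"
  assumes loc: "loc_lattice TYPE('a)"
    and inc: "incomparable a b" "incomparable c b" "incomparable d b"
    and op: "\<not> same_side b a c" "\<not> same_side b c d"
  shows "same_side b a d"
proof (rule ccontr)
  assume "\<not> same_side b a d"
  with op have le: "b \<le> sup a d" "b \<le> sup a c" "b \<le> sup c d"
    by (simp_all add: same_side_def)
  then have i: "incomparable a c" "incomparable c d" "incomparable a d"
    using inc op \<open>\<not> same_side b a d\<close> same_side_if_comparable by blast+
  have False if "x \<le> sup y z" "b \<le> sup x y" "b \<le> sup x z"
    "incomparable x y" "incomparable x z" "incomparable y z" "incomparable x b" for x y z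
  proof -
    have "inf (sup y x) (sup z x) = x"
      using loc_lattice_middle[OF loc, of y z x] that by (simp add: incomparable_sym)
    then have "b \<le> x" using that by (metis le_inf_iff sup_commute)
    then show False using that by (simp add: incomparable_def)
  qed
  with loc_lattice_one_below_join[OF loc, of a c d] le i inc show False
    by (metis incomparable_sym sup_commute)
qed

lemma same_side_parity:
  fixes a b c d :: "'a::bounded_lattice_bot"
  assumes "loc_lattice TYPE('a)"
    and "incomparable a b" "incomparable c b" "incomparable d b"
  shows "same_side b a d \<longleftrightarrow> (same_side b a c \<longleftrightarrow> same_side b c d)"
  using assms same_side_trans opposite_sides same_side_sym by metis

lemma middle_unique:
  fixes x y z :: "'a::bounded_lattice_bot"
  assumes loc: "loc_lattice TYPE('a)" and "\<not> same_side x y z"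
    and inc: "incomparable x y" "incomparable x z" "incomparable y z"
  shows "same_side y x z"
proof (rule ccontr)
  assume "\<not> same_side y x z"
  then have le: "y \<le> sup x z" "x \<le> sup y z"
    using assms by (simp_all add: same_side_def)
  then have "y \<le> inf (sup y x) (sup z x)" by (simp add: sup_commute)
  also have "\<dots> = x"
    using loc_lattice_middle[OF loc, of y z x] inc le by (simp add: incomparable_sym)
  finally show False using inc by (simp add: incomparable_def)
qed

lemma triangle_parity:
  fixes a b c :: "'a::bounded_lattice_bot"
  assumes loc: "loc_lattice TYPE('a)"
    and inc: "incomparable a b" "incomparable b c" "incomparable a c"
  shows "same_side a b c \<longleftrightarrow> (same_side b a c \<noteq> same_side c a b)"
proof -
  have "\<not> (same_side a b c \<and> same_side b a c \<and> same_side c a b)"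
    using loc_lattice_one_below_join[OF loc, of a b c] by (auto simp: same_side_def)
  then show ?thesis
    using middle_unique[OF loc, of a b c] middle_unique[OF loc, of a c b]
      middle_unique[OF loc, of b a c] middle_unique[OF loc, of b c a]
      middle_unique[OF loc, of c a b] middle_unique[OF loc, of c b a] inc
    by (metis incomparable_sym same_side_sym)
qed

text \<open>
  A four-cycle with a chord consists of two triangles.  Without a chord, opposite corners are
  comparable, and then each corner sees its two neighbours on the same side.
\<close>

lemma square_parity:
  fixes a b c d :: "'a::bounded_lattice_bot"
  assumes loc: "loc_lattice TYPE('a)"
    and inc: "incomparable a b" "incomparable b c" "incomparable c d" "incomparable d a"
  shows "(same_side b a c \<longleftrightarrow> same_side c b d) \<longleftrightarrow> (same_side d c a \<longleftrightarrow> same_side a d b)"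
proof -
  note sym = incomparable_sym same_side_sym
  have chord: ?thesis if
    "incomparable a c" using triangle_parity[OF loc, of a b c] triangle_parity[OF loc, of a c d]
      same_side_parity[OF loc, of d a c b] same_side_parity[OF loc, of d c a b] inc that
    by (metis sym)
  have chord': ?thesis if
    "incomparable b d" using triangle_parity[OF loc, of a b d] triangle_parity[OF loc, of b c d]
      same_side_parity[OF loc, of a b d c] same_side_parity[OF loc, of a d b c] inc that
    by (metis sym)
  show ?thesis
  proof (cases "incomparable a c \<or> incomparable b d")
    case True
    then show ?thesis using chord chord' by blast
  next
    case False
    then show ?thesis using same_side_if_comparable inc by (metis sym)
  qed
qed

section \<open>Closed walks of incomparable elements\<close>

text \<open>
  A list of successively incomparable elements is a walk, each step of which leads to the left or
  to the right.  At \<open>b\<close>, between \<open>a\<close> and \<open>c\<close>, the direction is reversed if \<open>a\<close> and \<open>c\<close> are on the same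
  side of \<open>b\<close>, and kept otherwise.  The parity of the number of reversals compares the directions of
  the first and the last step.
\<close>

fun odd_turns :: "'a::bounded_lattice_bot list \<Rightarrow> bool" where
  "odd_turns (a # b # c # xs) \<longleftrightarrow> same_side b a c \<noteq> odd_turns (b # c # xs)"
| "odd_turns _ \<longleftrightarrow> False"

lemma odd_turns_append:
  "odd_turns (xs @ a # b # ys) \<longleftrightarrow> odd_turns (xs @ [a, b]) \<noteq> odd_turns (a # b # ys)"
  by (induction xs rule: odd_turns.induct) auto

lemma odd_turns_rev: "odd_turns (rev xs) \<longleftrightarrow> odd_turns xs"
proof (induction xs rule: odd_turns.induct)
  case (1 a b c xs)
  have "odd_turns (rev xs @ c # b # [a]) \<longleftrightarrow> odd_turns (rev xs @ [c, b]) \<noteq> odd_turns [c, b, a]"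
    by (rule odd_turns_append)
  then show ?case using 1 by (auto simp: same_side_sym)
qed auto

lemma odd_turns_change_end:
  fixes a b c :: "'a::bounded_lattice_bot"
  assumes loc: "loc_lattice TYPE('a)" and "zs \<noteq> []"
    and "incomparable (last zs) a" "incomparable b a" "incomparable c a"
  shows "odd_turns (zs @ [a, b]) \<longleftrightarrow> (odd_turns (zs @ [a, c]) \<longleftrightarrow> same_side a c b)"
proof -
  obtain ws e where zs: "zs = ws @ [e]" using \<open>zs \<noteq> []\<close> by (metis append_butlast_last_id)
  have "odd_turns (ws @ e # a # [x]) \<longleftrightarrow> odd_turns (ws @ [e, a]) \<noteq> same_side a e x" for x
    by (subst odd_turns_append) simp
  then show ?thesis using same_side_parity[OF loc, of e a c b] assms by (auto simp: zs)
qed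

lemma odd_turns_change_start:
  fixes a b c :: "'a::bounded_lattice_bot"
  assumes "loc_lattice TYPE('a)" "zs \<noteq> []"
    and "incomparable (hd zs) a" "incomparable b a" "incomparable c a"
  shows "odd_turns (b # a # zs) \<longleftrightarrow> (odd_turns (c # a # zs) \<longleftrightarrow> same_side a c b)"
  using odd_turns_change_end[of "rev zs" a b c] assms
    odd_turns_rev[of "b # a # zs"] odd_turns_rev[of "c # a # zs"]
  by (simp add: last_rev)

text \<open>
  The closing edge is not repeated in the list, so that closed walks can be rotated; the turns at
  the last and at the first vertex are counted by appending the first two vertices again.
\<close>

definition odd_closed_walk :: "'a::bounded_lattice_bot list \<Rightarrow> bool" where
  "odd_closed_walk xs \<longleftrightarrow>
     2 \<le> length xs \<and> successively incomparable (xs @ take 1 xs) \<and> odd_turns (xs @ take 2 xs)"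

text \<open>
  Rotation moves one turn from the start to the end.  A closed walk of two elements
  reverses twice, so it is not odd.
\<close>

lemma odd_closed_walk_rotate1:
  assumes "odd_closed_walk xs" shows "odd_closed_walk (rotate1 xs)"
proof -
  obtain a b ys where xs: "xs = a # b # ys"
    using assms by (cases xs; cases "tl xs") (auto simp: odd_closed_walk_def)
  show ?thesis
  proof (cases ys)
    case Nil
    then show ?thesis
      using assms by (auto simp: odd_closed_walk_def xs same_side_def incomparable_def)
  next
    case (Cons c zs)
    have "odd_turns ((b # c # zs) @ a # b # [c]) \<longleftrightarrow>
        odd_turns ((b # c # zs) @ [a, b]) \<noteq> odd_turns (a # b # [c])"
      by (rule odd_turns_append)
    then show ?thesis
      using assms
      by (auto simp: odd_closed_walk_def xs Cons successively_append_iff successively_Cons hd_append)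
  qed
qed

lemma odd_closed_walk_rotate:
  "odd_closed_walk xs \<Longrightarrow> odd_closed_walk (rotate n xs)"
  by (induction n) (auto intro: odd_closed_walk_rotate1)

lemma odd_closed_walk_swap: "odd_closed_walk (xs @ ys) \<Longrightarrow> odd_closed_walk (ys @ xs)"
  using odd_closed_walk_rotate[of "xs @ ys" "length xs"] by (simp add: rotate_append)

text \<open>
  Replacing a corner by a chord changes the number of reversals by an even number: the turns
  at both ends of the chord change by what \<open>same_side_parity\<close> predicts, and these changes are
  balanced by the turn that disappears, because a triangle has an even number of reversals.
\<close>

lemma odd_closed_walk_cut_triangle:
  fixes a b c :: "'a::bounded_lattice_bot"
  assumes loc: "loc_lattice TYPE('a)"
    and odd: "odd_closed_walk (a # b # c # zs)" and "zs \<noteq> []" and ac: "incomparable a c"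
  shows "odd_closed_walk (a # c # zs)"
proof -
  have w: "successively incomparable (c # zs @ [a])" "incomparable a b" "incomparable b c"
    using odd by (auto simp: odd_closed_walk_def)
  then have e: "incomparable (last zs) a" "incomparable c (hd zs)"
    using \<open>zs \<noteq> []\<close> by (auto simp: successively_append_iff successively_Cons)
  have "odd_turns (b # c # zs @ [a, b]) \<longleftrightarrow> (odd_turns (a # c # zs @ [a, b]) \<longleftrightarrow> same_side c a b)"
    using odd_turns_change_start[OF loc, of "zs @ [a, b]" c b a] e w ac \<open>zs \<noteq> []\<close>
    by (simp add: incomparable_sym)
  moreover have "odd_turns ((a # c # zs) @ [a, b]) \<longleftrightarrow>
      (odd_turns ((a # c # zs) @ [a, c]) \<longleftrightarrow> same_side a c b)"
    using odd_turns_change_end[OF loc, of "a # c # zs" a b c] e w ac \<open>zs \<noteq> []\<close>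
    by (simp add: incomparable_sym)
  ultimately have "odd_turns (a # c # zs @ [a, c])"
    using odd triangle_parity[OF loc w(2,3) ac]
    by (auto simp: odd_closed_walk_def same_side_sym[of a c b])
  then show ?thesis using w ac by (simp add: odd_closed_walk_def)
qed

lemma odd_closed_walk_cut_square:
  fixes a b c :: "'a::bounded_lattice_bot"
  assumes loc: "loc_lattice TYPE('a)"
    and odd: "odd_closed_walk (a # b # c # d # zs)" and ad: "incomparable a d"
  shows "odd_closed_walk (a # d # zs)"
proof -
  have w: "successively incomparable (d # zs @ [a])"
      "incomparable a b" "incomparable b c" "incomparable c d"
    using odd by (auto simp: odd_closed_walk_def)
  then have e: "incomparable (last (d # zs)) a" "incomparable d (hd (zs @ [a, b]))"
    by (cases zs; auto simp: successively_append_iff successively_Cons)+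
  have "odd_turns (c # d # zs @ [a, b]) \<longleftrightarrow> (odd_turns (a # d # zs @ [a, b]) \<longleftrightarrow> same_side d a c)"
    using odd_turns_change_start[OF loc, of "zs @ [a, b]" d c a] e w ad
    by (simp add: incomparable_sym)
  moreover have "odd_turns ((a # d # zs) @ [a, b]) \<longleftrightarrow>
      (odd_turns ((a # d # zs) @ [a, d]) \<longleftrightarrow> same_side a d b)"
    using odd_turns_change_end[OF loc, of "a # d # zs" a b d] e w ad
    by (simp add: incomparable_sym)
  ultimately have "odd_turns (a # d # zs @ [a, d])"
    using odd square_parity[OF loc w(2-4)] ad incomparable_sym[of a d]
    by (auto simp: odd_closed_walk_def same_side_sym[of d a c])
  then show ?thesis using w ad by (simp add: odd_closed_walk_def)
qed

text \<open>
  In an odd closed walk of minimal length, no element is incomparable to the one two or three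
  places later, by the two cutting lemmas, and the length is at least five.  Around an
  element \<open>c\<close> that is minimal in the walk, consider \<open>a, b, c, d, e\<close>.  Then \<open>c\<close> lies below \<open>a\<close> and
  \<open>e\<close>; hence \<open>d \<le> a\<close> and \<open>b \<le> e\<close>, since the reverse inequalities would make \<open>c\<close> comparable to its
  neighbours; and now \<open>b \<le> d\<close> would make \<open>a\<close> and \<open>b\<close> comparable, and \<open>d \<le> b\<close> would make \<open>d\<close> and
  \<open>e\<close> comparable.
\<close>

lemma no_odd_closed_walk:
  fixes xs :: "'a::bounded_lattice_bot list"
  assumes loc: "loc_lattice TYPE('a)"
  shows "\<not> odd_closed_walk xs"
proof (induction "length xs" arbitrary: xs rule: less_induct)
  case less
  show ?case
  proof
    assume odd: "odd_closed_walk xs"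
    have no2: "\<not> incomparable a c"
      if "odd_closed_walk (a # b # c # zs)" "length (a # b # c # zs) = length xs" "zs \<noteq> []"
      for a b c :: 'a and zs
      using odd_closed_walk_cut_triangle[OF loc that(1) that(3)] less[of "a # c # zs"] that by auto
    have no3: "\<not> incomparable a d"
      if "odd_closed_walk (a # b # c # d # zs)" "length (a # b # c # d # zs) = length xs"
      for a b c d :: 'a and zs
      using odd_closed_walk_cut_square[OF loc that(1)] less[of "a # d # zs"] that by auto
    have len: "5 \<le> length xs"
    proof (rule ccontr)
      assume "\<not> 5 \<le> length xs"
      moreover have "2 \<le> length xs" using odd by (simp add: odd_closed_walk_def)
      ultimately consider a b where "xs = [a, b]" | a b c where "xs = [a, b, c]"
        | a b c d where "xs = [a, b, c, d]"
        by (cases xs; cases "tl xs"; cases "tl (tl xs)"; cases "tl (tl (tl xs))";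
            cases "tl (tl (tl (tl xs)))") auto
      then show False
      proof cases
        case 1
        then show ?thesis using odd by (auto simp: odd_closed_walk_def same_side_refl incomparable_sym)
      next
        case 2
        then show ?thesis using odd triangle_parity[OF loc, of a b c]
          by (auto simp: odd_closed_walk_def same_side_sym incomparable_sym)
      next
        case 3
        then show ?thesis using odd no3[of a b c d "[]"]
          by (auto simp: odd_closed_walk_def incomparable_sym)
      qed
    qed
    have "set xs \<noteq> {}" using len by auto
    then obtain c where c: "c \<in> set xs" "\<And>x. x \<in> set xs \<Longrightarrow> x \<le> c \<Longrightarrow> c \<le> x"
      using finite_has_minimal[of "set xs"] by auto
    from c(1) obtain us vs where xs: "xs = us @ c # vs" by (meson split_list)
    \<comment> \<open>The walk is rotated twice, to put the minimal element \<open>c\<close> first and then third.\<close>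
    define l where "l = c # vs @ us"
    have l: "odd_closed_walk l" "length l = length xs" "set l = set xs"
      using odd_closed_walk_swap[of us "c # vs"] odd xs by (auto simp: l_def)
    have "2 \<le> length (vs @ us)" using len xs by simp
    then obtain m a b where "vs @ us = m @ [a, b]"
      by (cases "vs @ us" rule: rev_cases; cases "butlast (vs @ us)" rule: rev_cases) auto
    then have "l = c # m @ [a, b]" by (simp add: l_def)
    moreover from this obtain d e m' where "m = d # e # m'"
      using len l(2) by (cases m; cases "tl m") auto
    ultimately have "l = (c # d # e # m') @ [a, b]" by simp
    then have w: "odd_closed_walk (a # b # c # d # e # m')"
        "length (a # b # c # d # e # m') = length xs" "set xs = set (a # b # c # d # e # m')"
      using odd_closed_walk_swap[of "c # d # e # m'" "[a, b]"] l by auto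
    from odd_closed_walk_rotate1[OF w(1)] have w1: "odd_closed_walk (b # c # d # e # m' @ [a])" by simp
    from odd_closed_walk_rotate1[OF w1] have w2: "odd_closed_walk (c # d # e # m' @ [a, b])" by simp
    have comp: "\<not> incomparable a c" "\<not> incomparable b d" "\<not> incomparable c e"
        "\<not> incomparable a d" "\<not> incomparable b e"
      using no2[OF w(1)] no2[OF w1] no2[OF w2] no3[OF w(1)] no3[OF w1] w(2) by auto
    have inc: "incomparable a b" "incomparable b c" "incomparable c d" "incomparable d e"
      using w(1) by (auto simp: odd_closed_walk_def)
    have "c \<le> a" "c \<le> e" using c(2)[of a] c(2)[of e] w(3) comp by (auto simp: incomparable_def)
    then have "d \<le> a" "b \<le> e"
      using comp inc order_trans[of c a d] order_trans[of c e b] by (auto simp: incomparable_def)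
    then show False
      using comp inc order_trans[of b d a] order_trans[of d b e] by (auto simp: incomparable_def)
  qed
qed


section \<open>Orienting incomparable elements\<close>

text \<open>
  Walks are compared through their first step, from \<open>p\<close> to \<open>q\<close>, and their last step, from \<open>a\<close>
  to \<open>b\<close>.
\<close>

definition walk :: "'a::bounded_lattice_bot list \<Rightarrow> 'a \<Rightarrow> 'a \<Rightarrow> 'a \<Rightarrow> 'a \<Rightarrow> bool" where
  "walk xs p q a b \<longleftrightarrow>
     successively incomparable xs \<and> (\<exists>ys. xs = p # q # ys) \<and> (\<exists>zs. xs = zs @ [a, b])"

lemma walk_extend:
  assumes "walk xs p q a b" "incomparable b c"
  shows "walk (xs @ [c]) p q b c" "odd_turns (xs @ [c]) \<longleftrightarrow> odd_turns xs \<noteq> same_side b a c"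
proof -
  obtain zs where zs: "xs = zs @ [a, b]" using assms(1) by (auto simp: walk_def)
  have "successively incomparable (xs @ [c])"
    using assms by (auto simp: walk_def zs successively_append_iff)
  moreover obtain ys where "xs = p # q # ys" using assms(1) by (auto simp: walk_def)
  then have "xs @ [c] = p # q # (ys @ [c])" by simp
  moreover have "xs @ [c] = (zs @ [a]) @ [b, c]" by (simp add: zs)
  ultimately show "walk (xs @ [c]) p q b c"
    unfolding walk_def by blast
  show "odd_turns (xs @ [c]) \<longleftrightarrow> odd_turns xs \<noteq> same_side b a c"
    using odd_turns_append[of zs a b "[c]"] by (simp add: zs)
qed

text \<open>
  One walk followed by the other one backwards is a closed walk, with two further reversals
  where the walks are joined.
\<close>

lemma walk_parity_unique:
  fixes a b p q :: "'a::bounded_lattice_bot"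
  assumes loc: "loc_lattice TYPE('a)" and "walk xs p q a b" "walk ys p q a b"
  shows "odd_turns xs \<longleftrightarrow> odd_turns ys"
proof -
  obtain zs zs' m m' where xs: "xs = zs @ [a, b]" "xs = p # q # m"
    and ys: "ys = zs' @ [a, b]" "ys = p # q # m'"
    using assms by (auto simp: walk_def)
  have inc: "incomparable p q" "incomparable a b"
    using assms(2) by (simp add: walk_def xs(2))
      (use assms(2) in \<open>simp add: walk_def xs(1) successively_append_iff\<close>)
  have rev: "rev ys = b # a # rev zs'" "rev ys = rev m' @ [q, p]"
    by (simp add: ys(1)) (simp add: ys(2))
  then have "b # a # rev zs' = (rev m' @ [q]) @ [p]" by simp
  then have "tl (b # a # rev zs') = tl ((rev m' @ [q]) @ [p])" by (rule arg_cong)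
  then have tl: "a # rev zs' = tl (rev m' @ [q]) @ [p]"
    by (subst (asm) tl_append2) simp_all
  define l where "l = p # q # m @ tl (rev m' @ [q])"
  have l: "l @ [p] = xs @ (a # rev zs')"
    by (simp add: l_def tl xs(2))
  have "successively incomparable (rev ys)"
    using assms(3) by (simp add: walk_def incomparable_sym)
  then have "successively incomparable (xs @ (a # rev zs'))"
    using assms(2) inc unfolding rev(1)
    by (auto simp: walk_def successively_append_iff xs(1) incomparable_sym)
  then have "successively incomparable (l @ [p])" by (simp only: l)
  moreover have take: "take 1 l = [p]" "take 2 l = [p, q]" "2 \<le> length l" by (simp_all add: l_def)
  ultimately have even: "\<not> odd_turns (l @ [p, q])"
    using no_odd_closed_walk[OF loc, of l] unfolding odd_closed_walk_def by simp
  have "l @ [p, q] = (l @ [p]) @ [q]" by simp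
  also have "\<dots> = zs @ a # b # (a # rev zs' @ [q])" unfolding l xs(1) by simp
  finally have closed: "l @ [p, q] = zs @ a # b # (a # rev zs' @ [q])" .
  have 1: "odd_turns (l @ [p, q]) \<longleftrightarrow>
      odd_turns xs \<noteq> odd_turns (a # b # (a # rev zs' @ [q]))"
    unfolding closed xs(1) by (rule odd_turns_append)
  have 2: "odd_turns (a # b # (a # rev zs' @ [q])) \<longleftrightarrow> \<not> odd_turns (b # a # rev zs' @ [q])"
    using same_side_refl[OF inc(2)] by simp
  have "b # a # rev zs' @ [q] = rev ys @ [q]" by (simp only: rev(1) append_Cons)
  also have "\<dots> = rev m' @ q # p # [q]" by (simp only: rev(2)) simp
  finally have 3: "odd_turns (b # a # rev zs' @ [q]) \<longleftrightarrow> odd_turns (rev ys) \<noteq> same_side p q q"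
    using odd_turns_append[of "rev m'" q p "[q]"] by (simp only: rev(2)) simp
  have "same_side p q q" using inc(1) by (simp add: same_side_refl incomparable_sym)
  then show ?thesis using 1 2 3 even odd_turns_rev[of ys] by blast
qed

text \<open>
  In each connected component of the incomparability graph, one step, from \<open>P a\<close> to \<open>Q a\<close>, is
  declared to lead to the right.  A further step leads to the right if it is reached from this one with an even
  number of reversals.
\<close>

theorem loc_lattice_orientation:
  assumes loc: "loc_lattice TYPE('a::bounded_lattice_bot)"
  obtains before :: "'a::bounded_lattice_bot \<Rightarrow> 'a \<Rightarrow> bool"
  where "\<And>a b. incomparable a b \<Longrightarrow> before a b \<longleftrightarrow> \<not> before b a"
    and "\<And>a b c. incomparable a b \<Longrightarrow> incomparable b c \<Longrightarrow>
      b \<le> sup a c \<longleftrightarrow> (before a b \<longleftrightarrow> before b c)"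
proof -
  define P where "P a = (SOME p. incomparable\<^sup>*\<^sup>* a p)" for a :: 'a
  define Q where "Q a = (SOME q. incomparable (P a) q)" for a :: 'a
  define before where
    "before a b \<longleftrightarrow> (\<exists>xs. walk xs (P a) (Q a) a b \<and> \<not> odd_turns xs)" for a b
  have P: "incomparable\<^sup>*\<^sup>* a (P a)" for a
    unfolding P_def by (rule someI[of _ a]) simp
  have conn_sym: "incomparable\<^sup>*\<^sup>* b a" if "incomparable\<^sup>*\<^sup>* a b" for a b :: 'a
    using that symp_rtranclp[of "incomparable :: 'a \<Rightarrow> 'a \<Rightarrow> bool"]
    by (auto simp: symp_def incomparable_sym)
  \<comment> \<open>The choices depend on the connected component only, as the defining predicates do.\<close>
  have same: "P a = P b" "Q a = Q b" if "incomparable a b" for a b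
  proof -
    have "incomparable\<^sup>*\<^sup>* a = incomparable\<^sup>*\<^sup>* b"
      using that incomparable_sym[of a b]
      by (intro ext iffI) (auto intro: converse_rtranclp_into_rtranclp)
    then show "P a = P b" by (simp add: P_def)
    then show "Q a = Q b" by (simp add: Q_def)
  qed
  have ex: "\<exists>xs. walk xs (P a) (Q a) a b" if "incomparable a b" for a b
  proof -
    obtain p q where pq: "p = P a" "q = Q a" by blast
    have q: "incomparable p q"
    proof -
      have "\<exists>q. incomparable p q"
      proof (cases "p = a")
        case True
        then show ?thesis using that by blast
      next
        case False
        have "incomparable\<^sup>*\<^sup>* p a" using P conn_sym pq by blast
        then show ?thesis using False by (cases rule: converse_rtranclpE) auto
      qed
      then show ?thesis unfolding pq Q_def by (rule someI_ex)
    qed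
    have "incomparable\<^sup>*\<^sup>* p a" using P conn_sym pq by blast
    \<comment> \<open>The first step is fixed, so a walk that leaves \<open>p\<close> in another direction goes to \<open>q\<close> and back first.\<close>
    then have "\<forall>b. incomparable a b \<longrightarrow> (\<exists>xs. walk xs p q a b)"
    proof (induction rule: rtranclp_induct)
      case base
      have "walk [p, q, p, b] p q p b" if "incomparable p b" for b
        using that q by (auto simp: walk_def incomparable_sym)
      then show ?case by blast
    next
      case (step y z)
      then show ?case using walk_extend(1) by blast
    qed
    then show ?thesis using that pq by blast
  qed
  have before_iff: "before a b \<longleftrightarrow> \<not> odd_turns xs" if "walk xs (P a) (Q a) a b" for a b xs
    using walk_parity_unique[OF loc that] that unfolding before_def by blast
  have next_edge: "before b c \<longleftrightarrow> (before a b \<longleftrightarrow> \<not> same_side b a c)"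
    if "incomparable a b" "incomparable b c" for a b c
  proof -
    obtain xs where xs: "walk xs (P a) (Q a) a b" using ex \<open>incomparable a b\<close> by blast
    note ext = walk_extend[OF xs \<open>incomparable b c\<close>]
    then show ?thesis
      using before_iff[OF xs] before_iff[of "xs @ [c]" b c] same[OF \<open>incomparable a b\<close>] by auto
  qed
  show ?thesis
  proof (rule that)
    show "before a b \<longleftrightarrow> \<not> before b a" if "incomparable a b" for a b
      using next_edge[of a b a] that by (simp add: incomparable_sym same_side_refl)
    show "b \<le> sup a c \<longleftrightarrow> (before a b \<longleftrightarrow> before b c)"
      if "incomparable a b" "incomparable b c" for a b c
      using next_edge[OF that] by (auto simp: same_side_def)
  qed
qed


locale oriented_loc_lattice =
  fixes before :: "'a::bounded_lattice_bot \<Rightarrow> 'a \<Rightarrow> bool"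
  assumes loc: "loc_lattice TYPE('a)"
    and before_asym: "incomparable a b \<Longrightarrow> before a b \<longleftrightarrow> \<not> before b a"
    and between_iff: "incomparable a b \<Longrightarrow> incomparable b c \<Longrightarrow>
      b \<le> sup a c \<longleftrightarrow> (before a b \<longleftrightarrow> before b c)"
begin

lemma before_comparable_left:
  assumes "incomparable a b" "incomparable c b" "\<not> incomparable a c"
  shows "before a b \<longleftrightarrow> before c b"
  using same_side_if_comparable[OF assms] between_iff[of a b c] before_asym[of b c] assms
  by (auto simp: same_side_def incomparable_sym)

lemma before_comparable_right:
  assumes "incomparable b a" "incomparable b c" "\<not> incomparable a c"
  shows "before b a \<longleftrightarrow> before b c"
  using before_comparable_left[of a b c] before_asym[of b a] before_asym[of b c] assms
  by (simp add: incomparable_sym)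

text \<open>
  Here \<open>b\<close> is the middle one of the three, so \<open>b\<close> and \<open>c\<close> are on the same side of \<open>a\<close>.
\<close>

lemma before_trans:
  assumes inc: "incomparable a b" "incomparable b c" and "before a b" "before b c"
  shows "incomparable a c" "before a c"
proof -
  have b: "\<not> same_side b a c" using assms between_iff by (simp add: same_side_def)
  then show ac: "incomparable a c"
    using same_side_if_comparable inc by (metis incomparable_sym)
  have "same_side a b c"
    using middle_unique[OF loc b] inc ac by (simp add: incomparable_sym)
  then show "before a c"
    using between_iff[of b a c] before_asym[of a b] inc ac assms
    by (auto simp: same_side_def incomparable_sym)
qed

end

section \<open>Semi-prime filters\<close>

text \<open>
  Let \<open>M\<close> be maximal among the filters that contain \<open>y\<close> and omit \<open>x\<close>.  Every \<open>a \<notin> M\<close> meets some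
  member of \<open>M\<close> below \<open>x\<close>.  So if neither \<open>a\<close> nor \<open>b\<close> is in \<open>M\<close> but \<open>sup a b\<close> is, then some \<open>e \<in> M\<close> below
  \<open>sup a b\<close> has both \<open>inf a e\<close> and \<open>inf b e\<close> below \<open>x\<close>, and their join is not \<open>e\<close>.
\<close>

lemma semi_prime_separation:
  fixes x y :: "'a::bounded_lattice_bot"
  assumes "\<not> y \<le> x"
  obtains F where "semi_prime_filter F" "y \<in> F" "x \<notin> F"
proof -
  define A where "A = {F. y \<in> F \<and> x \<notin> F \<and> (\<forall>a b. a \<in> F \<and> a \<le> b \<longrightarrow> b \<in> F) \<and>
      (\<forall>a b. a \<in> F \<and> b \<in> F \<longrightarrow> inf a b \<in> F)}"
  have AI: "F \<in> A" if "y \<in> F" "x \<notin> F" "\<And>a b. a \<in> F \<Longrightarrow> a \<le> b \<Longrightarrow> b \<in> F"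
    "\<And>a b. a \<in> F \<Longrightarrow> b \<in> F \<Longrightarrow> inf a b \<in> F" for F
    unfolding A_def by (intro CollectI conjI allI impI that(1,2); elim conjE; erule (1) that(3,4))
  have A: "y \<in> F" "x \<notin> F" "\<And>a b. a \<in> F \<Longrightarrow> a \<le> b \<Longrightarrow> b \<in> F"
    "\<And>a b. a \<in> F \<Longrightarrow> b \<in> F \<Longrightarrow> inf a b \<in> F" if "F \<in> A" for F
    using that unfolding A_def by blast+
  have "\<exists>M\<in>A. \<forall>F\<in>A. M \<subseteq> F \<longrightarrow> F = M"
  proof (rule subset_Zorn_nonempty)
    have "{z. y \<le> z} \<in> A"
      using assms by (intro AI) simp_all
    then show "A \<noteq> {}" by blast
    fix C assume C: "C \<noteq> {}" "subset.chain A C"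
    then have CA: "F \<in> A" if "F \<in> C" for F using that by (auto simp: subset_chain_def)
    show "\<Union> C \<in> A"
    proof (rule AI)
      show "y \<in> \<Union> C" using C(1) CA A(1) by blast
      show "x \<notin> \<Union> C" using CA A(2) by blast
      show "b \<in> \<Union> C" if "a \<in> \<Union> C" "a \<le> b" for a b
        using that CA A(3) by blast
      fix a b assume "a \<in> \<Union> C" "b \<in> \<Union> C"
      then obtain F G where FG: "F \<in> C" "G \<in> C" "a \<in> F" "b \<in> G" by blast
      then have "F \<subseteq> G \<or> G \<subseteq> F" using C by (auto simp: subset_chain_def)
      then obtain H where "H \<in> C" "a \<in> H" "b \<in> H" using FG by blast
      then show "inf a b \<in> \<Union> C" using CA A(4) by blast
    qed
  qed
  then obtain M where M: "M \<in> A" and max: "\<And>F. F \<in> A \<Longrightarrow> M \<subseteq> F \<Longrightarrow> F = M" by blast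
  note up = A(3)[OF M] and meet = A(4)[OF M]
  have hit: "\<exists>c\<in>M. inf a c \<le> x" if "a \<notin> M" for a
  proof (rule ccontr)
    assume n: "\<not> (\<exists>c\<in>M. inf a c \<le> x)"
    define G where "G = {z. \<exists>c\<in>M. inf a c \<le> z}"
    have sub: "M \<subseteq> G" unfolding G_def using inf_le2 by blast
    have "G \<in> A"
    proof (rule AI)
      show "y \<in> G" using sub A(1)[OF M] by blast
      show "x \<notin> G" using n by (simp add: G_def)
      show "v \<in> G" if "u \<in> G" "u \<le> v" for u v
        using that order_trans[OF _ that(2)] unfolding G_def by blast
      fix u v assume "u \<in> G" "v \<in> G"
      then obtain c d where cd: "c \<in> M" "d \<in> M" "inf a c \<le> u" "inf a d \<le> v"
        unfolding G_def by blast
      have "inf a (inf c d) \<le> inf a c" "inf a (inf c d) \<le> inf a d"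
        by (simp_all add: le_infI2)
      then have "inf a (inf c d) \<le> inf u v"
        using order_trans[OF _ cd(3)] order_trans[OF _ cd(4)] by (simp add: le_infI)
      then show "inf u v \<in> G" unfolding G_def using meet[OF cd(1,2)] by blast
    qed
    then have "G = M" using max sub by blast
    moreover have "a \<in> G" unfolding G_def using A(1)[OF M] inf_le1 by blast
    ultimately show False using that by blast
  qed
  have "semi_prime_filter M"
    unfolding semi_prime_filter_def
  proof (intro conjI allI impI)
    have "M \<noteq> {}" "M \<noteq> UNIV" using A(1,2)[OF M] by blast+
    then show "proper_lattice_filter M"
      unfolding proper_lattice_filter_def using up meet by auto
    fix a b assume ab: "sup a b \<in> M"
    show "a \<in> M \<or> b \<in> M \<or> (\<exists>c\<in>M. c \<le> sup a b \<and> c \<noteq> sup (inf a c) (inf b c))"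
    proof (cases "a \<in> M \<or> b \<in> M")
      case False
      then obtain c d where cd: "c \<in> M" "d \<in> M" "inf a c \<le> x" "inf b d \<le> x"
        using hit by meson
      define e where "e = inf (inf c d) (sup a b)"
      have "e \<in> M" using cd ab meet by (simp add: e_def)
      have "e \<le> c" "e \<le> d" by (simp_all add: e_def le_infI1)
      then have "inf a e \<le> x" "inf b e \<le> x"
        using order_trans[OF inf_mono[OF order_refl] cd(3)]
          order_trans[OF inf_mono[OF order_refl] cd(4)] by simp_all
      then have "sup (inf a e) (inf b e) \<le> x" by simp
      moreover have "\<not> e \<le> x" using up[OF \<open>e \<in> M\<close>] A(2)[OF M] by blast
      ultimately have "e \<noteq> sup (inf a e) (inf b e)" by metis
      moreover have "e \<le> sup a b" by (simp add: e_def)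
      ultimately show ?thesis using \<open>e \<in> M\<close> by blast
    qed blast
  qed
  then show ?thesis using that A(1,2)[OF M] by blast
qed

context oriented_loc_lattice
begin

context
  fixes F :: "'a set"
  assumes F: "semi_prime_filter F"
begin

lemma filter_up: "a \<in> F \<Longrightarrow> a \<le> b \<Longrightarrow> b \<in> F"
  using F unfolding semi_prime_filter_def proper_lattice_filter_def by blast

lemma filter_inf: "a \<in> F \<Longrightarrow> b \<in> F \<Longrightarrow> inf a b \<in> F"
  using F unfolding semi_prime_filter_def proper_lattice_filter_def by blast

lemma bot_notin_filter: "bot \<notin> F"
proof
  assume "bot \<in> F"
  then have "F = UNIV" using filter_up[OF _ bot_least] by blast
  then show False using F unfolding semi_prime_filter_def proper_lattice_filter_def by simp
qed

text \<open>
  If the join of \<open>a\<close> and \<open>b\<close> covers the point \<open>F\<close> but neither of them does, then an interval around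
  \<open>F\<close> inside the join is separated from one of them.
\<close>

lemma filter_gap:
  assumes "sup a b \<in> F" "a \<notin> F" "b \<notin> F"
  obtains e where "e \<in> F" "e \<le> sup a b" "inf a e = bot \<or> inf b e = bot"
proof -
  obtain e where "e \<in> F" "e \<le> sup a b" "e \<noteq> sup (inf a e) (inf b e)"
    using F assms unfolding semi_prime_filter_def by blast
  then show ?thesis using that loc_lattice_split[OF loc, of e a b] by blast
qed

text \<open>
  The analogue of \<open>same_side_trans\<close> with the point \<open>F\<close> in place of \<open>b\<close>.  A neighbourhood \<open>e\<close> of \<open>F\<close>
  that is separated from \<open>sup a c\<close> or from \<open>sup d c\<close> cannot contain \<open>c\<close>, yet it lies
  between these two joins, which share \<open>c\<close>; this contradicts the second axiom.
\<close>

lemma join_notin_trans: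
  assumes "c \<noteq> bot" and ac: "sup a c \<notin> F" and dc: "sup d c \<notin> F"
  shows "sup a d \<notin> F"
proof
  assume ad: "sup a d \<in> F"
  have "sup (sup a c) (sup d c) \<in> F"
    by (rule filter_up[OF ad]) (simp add: le_supI1 le_supI2)
  from filter_gap[OF this ac dc] obtain e where e: "e \<in> F" "e \<le> sup (sup a c) (sup d c)"
    "inf (sup a c) e = bot \<or> inf (sup d c) e = bot" by blast
  have ce: "\<not> c \<le> e"
  proof
    assume "c \<le> e"
    then have "c \<le> inf (sup a c) e" "c \<le> inf (sup d c) e" by simp_all
    then show False using e(3) \<open>c \<noteq> bot\<close> by (metis bot.extremum_uniqueI)
  qed
  have i: "incomparable (sup a c) e" "incomparable (sup d c) e"
    using ce e(1) filter_up ac dc unfolding incomparable_def by (auto dest: order_trans)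
  have "incomparable (sup a c) (sup d c)"
  proof (rule ccontr)
    assume "\<not> ?thesis"
    then have "sup a d \<le> sup a c \<or> sup a d \<le> sup d c"
      unfolding incomparable_def by (auto intro: order_trans[OF sup_ge1] order_trans[OF sup_ge2])
    then show False using filter_up[OF ad] ac dc by blast
  qed
  from loc_lattice_middle[OF loc this i e(2)] have "c \<le> e"
    by (metis inf_greatest le_supI1 sup_ge2)
  with ce show False ..
qed

text \<open>
  The analogue of \<open>opposite_sides\<close>: if all joins of two of the three elements were in \<open>F\<close>, then so
  would be the middle one of the three, as the meet of its joins with the other two.
\<close>

lemma join_in_opposite:
  assumes out: "a \<notin> F" "c \<notin> F" "d \<notin> F" and ac: "sup a c \<in> F" and cd: "sup c d \<in> F"
  shows "sup a d \<notin> F"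
proof
  assume ad: "sup a d \<in> F"
  have False if le: "x \<le> sup y z" and in_F: "sup y x \<in> F" "sup z x \<in> F" "sup y z \<in> F"
    and out: "x \<notin> F" "y \<notin> F" "z \<notin> F" for x y z
  proof -
    have inc: "incomparable u v" if "sup u v \<in> F" "u \<notin> F" "v \<notin> F" for u v
      using that by (auto simp: incomparable_def sup_absorb1 sup_absorb2)
    have "inf (sup y x) (sup z x) = x"
      by (rule loc_lattice_middle[OF loc]) (use le in_F out inc in auto)
    then show False using filter_inf in_F out by metis
  qed
  then show False
    using loc_lattice_one_below_join[OF loc, of a c d] ac cd ad out
    by (metis sup_commute)
qed

lemma join_notin_parity:
  assumes "a \<notin> F" "c \<notin> F" "d \<notin> F" "a \<noteq> bot" "c \<noteq> bot" "d \<noteq> bot"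
  shows "sup a d \<notin> F \<longleftrightarrow> (sup a c \<notin> F \<longleftrightarrow> sup c d \<notin> F)"
  using assms join_notin_trans join_in_opposite by (metis sup_commute)

lemma incomparable_inf:
  assumes "b \<notin> F" "c \<in> F" "incomparable b c" "d \<in> F"
  shows "incomparable b (inf c d)" "before b (inf c d) \<longleftrightarrow> before b c"
proof -
  have "inf c d \<in> F" using assms filter_inf by blast
  then show i: "incomparable b (inf c d)"
    using assms filter_up unfolding incomparable_def by (meson le_inf_iff)
  show "before b (inf c d) \<longleftrightarrow> before b c"
    by (rule before_comparable_right[OF i assms(3)]) (simp add: incomparable_def)
qed

text \<open>
  The sides of \<open>F\<close> agree with the orientation: two elements outside \<open>F\<close> that are incomparable to
  members of \<open>F\<close> are on the same side of \<open>F\<close> iff they are on the same side of these members.  All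
  members of \<open>F\<close> below a given one give the same answer, so one common member can be used for both.
\<close>

lemma join_notin_iff_before:
  assumes b: "b \<notin> F" "c \<in> F" "incomparable b c"
    and b': "b' \<notin> F" "c' \<in> F" "incomparable b' c'"
  shows "sup b b' \<notin> F \<longleftrightarrow> (before b c \<longleftrightarrow> before b' c')"
proof -
  define d where "d = inf c c'"
  have d: "d \<in> F" "incomparable b d" "incomparable b' d"
    "before b d \<longleftrightarrow> before b c" "before b' d \<longleftrightarrow> before b' c'"
    using incomparable_inf[OF b b'(2)] incomparable_inf[OF b' b(2)] filter_inf b b'
    by (auto simp: d_def inf_commute)
  have split: "x \<le> sup b b' \<longleftrightarrow> before b x \<noteq> before b' x"
    if "incomparable b x" "incomparable b' x" for x
    using between_iff[of b x b'] before_asym[of b' x] that by (auto simp: incomparable_sym)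
  show ?thesis
  proof
    assume "sup b b' \<notin> F"
    then have "\<not> d \<le> sup b b'" using filter_up d by blast
    then show "before b c \<longleftrightarrow> before b' c'" using split d by blast
  next
    assume same: "before b c \<longleftrightarrow> before b' c'"
    show "sup b b' \<notin> F"
    proof
      assume j: "sup b b' \<in> F"
      define e where "e = inf d (sup b b')"
      have "incomparable b e" "incomparable b' e" "before b e \<longleftrightarrow> before b' e"
        using incomparable_inf[OF b(1) d(1,2) j] incomparable_inf[OF b'(1) d(1,3) j] d same
        by (auto simp: e_def)
      moreover have "e \<le> sup b b'" by (simp add: e_def)
      ultimately show False using split by blast
    qed
  qed
qed

end

text \<open>
  Used for \<open>a \<notin> F\<close>.  An element \<open>b\<close> outside \<open>F\<close> that is incomparable to some \<open>c \<in> F\<close> is on a side known from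
  the orientation, and \<open>a\<close> is compared with it.  If there is no such \<open>b\<close>, then every element outside
  \<open>F\<close> is below all of \<open>F\<close>; the two sides are then interchangeable, and the condition, being
  vacuous, puts all these elements to the left.
\<close>

definition left :: "'a set \<Rightarrow> 'a \<Rightarrow> bool" where
  "left F a \<longleftrightarrow>
     (\<forall>b c. b \<notin> F \<and> c \<in> F \<and> incomparable b c \<longrightarrow> (before b c \<longleftrightarrow> sup a b \<notin> F))"

lemma left_iff_before:
  assumes "semi_prime_filter F" "a \<notin> F" "c \<in> F" "incomparable a c"
  shows "left F a \<longleftrightarrow> before a c"
  using join_notin_iff_before[OF assms] assms(2-) unfolding left_def
  by (metis sup_idem)

text \<open>
  By \<open>join_notin_parity\<close> a single \<open>b\<close> of known side decides the condition for all others.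
\<close>

lemma left_iff_join_notin:
  assumes F: "semi_prime_filter F" and "a \<notin> F" "a \<noteq> bot"
    and b: "b \<notin> F" "c \<in> F" "incomparable b c"
  shows "left F a \<longleftrightarrow> (before b c \<longleftrightarrow> sup a b \<notin> F)"
proof
  show "left F a \<Longrightarrow> before b c \<longleftrightarrow> sup a b \<notin> F" using b by (auto simp: left_def)
  assume eq: "before b c \<longleftrightarrow> sup a b \<notin> F"
  have nz: "x \<noteq> bot" if "incomparable x y" for x y :: 'a
    using that by (auto simp: incomparable_def)
  show "left F a"
    unfolding left_def
  proof (intro allI impI)
    fix b' c' assume b': "b' \<notin> F \<and> c' \<in> F \<and> incomparable b' c'"
    then show "before b' c' \<longleftrightarrow> sup a b' \<notin> F"
      using join_notin_parity[OF F \<open>a \<notin> F\<close> b(1), of b'] join_notin_iff_before[OF F b, of b' c']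
        eq assms nz by blast
  qed
qed

lemma join_in_obtain_incomparable:
  fixes F :: "'a set"
  assumes F: "semi_prime_filter F" and "a \<notin> F" "c \<notin> F" "a \<noteq> bot" "c \<noteq> bot" "sup a c \<in> F"
  obtains e where "e \<in> F" "incomparable a e \<or> incomparable c e"
proof -
  obtain e where e: "e \<in> F" "inf a e = bot \<or> inf c e = bot"
    by (rule filter_gap[OF F \<open>sup a c \<in> F\<close> \<open>a \<notin> F\<close> \<open>c \<notin> F\<close>])
  have "\<not> e \<le> a" "\<not> e \<le> c" using filter_up[OF F e(1)] assms by blast+
  moreover have "\<not> a \<le> e \<or> \<not> c \<le> e" using e(2) assms by (metis inf_absorb1)
  ultimately show ?thesis using that e by (auto simp: incomparable_def)
qed

lemma left_eq_iff:
  assumes F: "semi_prime_filter F" and out: "a \<notin> F" "c \<notin> F" and nz: "a \<noteq> bot" "c \<noteq> bot"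
  shows "(left F a \<longleftrightarrow> left F c) \<longleftrightarrow> sup a c \<notin> F"
proof (cases "\<exists>b e. b \<notin> F \<and> e \<in> F \<and> incomparable b e")
  case True
  then obtain b e where b: "b \<notin> F" "e \<in> F" "incomparable b e" by blast
  then have "b \<noteq> bot" by (auto simp: incomparable_def)
  then show ?thesis
    using left_iff_join_notin[OF F out(1) nz(1) b] left_iff_join_notin[OF F out(2) nz(2) b]
      join_notin_parity[OF F out(1) b(1) out(2)] nz
    by (auto simp: sup_commute)
next
  case False
  then have "left F a" "left F c" by (auto simp: left_def)
  then show ?thesis using join_in_obtain_incomparable[OF F out nz] False out by metis
qed

lemma left_le:
  assumes "semi_prime_filter F" "a \<notin> F" "x \<le> a" "x \<noteq> bot"
  shows "left F x \<longleftrightarrow> left F a"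
proof -
  have "x \<notin> F" "a \<noteq> bot"
    using assms filter_up by (blast, metis bot.extremum_uniqueI)
  then show ?thesis using left_eq_iff[of F x a] assms by (simp add: sup_absorb2)
qed

lemma left_right_before:
  assumes F: "semi_prime_filter F" and out: "a \<notin> F" "c \<notin> F" and nz: "a \<noteq> bot" "c \<noteq> bot"
    and "left F a" "\<not> left F c"
  shows "incomparable a c" "before a c"
proof -
  have j: "sup a c \<in> F" using left_eq_iff[OF F out nz] assms by blast
  then show ac: "incomparable a c"
    using out by (auto simp: incomparable_def sup_absorb1 sup_absorb2)
  obtain e where e: "e \<in> F" "incomparable a e \<or> incomparable c e"
    using join_in_obtain_incomparable[OF F out nz j] .
  have "before a e" if "incomparable a e"
    using left_iff_before[OF F out(1) e(1) that] assms by blast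
  moreover have "before e c" if "incomparable c e"
    using left_iff_before[OF F out(2) e(1) that] before_asym[OF that] assms by blast
  ultimately show "before a c"
    using e(2) before_trans(2)[of a e c] before_comparable_left[of a c e]
      before_comparable_right[of a c e] ac
    by (metis incomparable_sym)
qed

text \<open>
  By \<open>filter_less_iff_left\<close> and \<open>filter_less_iff_right\<close> below, any element in the symmetric difference
  of two semi-prime filters decides their order.
\<close>

definition filter_less :: "'a set \<Rightarrow> 'a set \<Rightarrow> bool" where
  "filter_less F G \<longleftrightarrow>
     (\<exists>a. a \<in> F \<and> a \<notin> G \<and> left G a) \<or> (\<exists>b. b \<in> G \<and> b \<notin> F \<and> \<not> left F b)"

lemma difference_incomparable:
  assumes "semi_prime_filter F" "semi_prime_filter G" "a \<in> F" "a \<notin> G" "b \<in> G" "b \<notin> F"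
  shows "incomparable a b" "left G a \<longleftrightarrow> \<not> left F b"
proof -
  show i: "incomparable a b" using assms filter_up unfolding incomparable_def by metis
  show "left G a \<longleftrightarrow> \<not> left F b"
    using left_iff_before[of G a b] left_iff_before[of F b a] before_asym[OF i] i assms
    by (simp add: incomparable_sym)
qed

text \<open>
  The meet of \<open>a\<close> and \<open>b\<close> is nonzero, being in \<open>F\<close>, and it is on the same side of \<open>G\<close> as both of them.
\<close>

lemma left_difference_unique:
  assumes "semi_prime_filter F" "semi_prime_filter G"
    and "a \<in> F" "a \<notin> G" "b \<in> F" "b \<notin> G"
  shows "left G a \<longleftrightarrow> left G b"
proof -
  have "inf a b \<noteq> bot"
    using filter_inf[OF assms(1)] bot_notin_filter[OF assms(1)] assms by metis
  then show ?thesis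
    using left_le[of G a "inf a b"] left_le[of G b "inf a b"] assms by simp
qed

lemma filter_less_iff_left:
  assumes "semi_prime_filter F" "semi_prime_filter G" "a \<in> F" "a \<notin> G"
  shows "filter_less F G \<longleftrightarrow> left G a"
  using assms left_difference_unique difference_incomparable(2) unfolding filter_less_def by metis

lemma filter_less_iff_right:
  assumes "semi_prime_filter F" "semi_prime_filter G" "b \<in> G" "b \<notin> F"
  shows "filter_less F G \<longleftrightarrow> \<not> left F b"
  using assms left_difference_unique difference_incomparable(2) unfolding filter_less_def by metis

lemma filter_less_asym:
  assumes "semi_prime_filter F" "semi_prime_filter G" "F \<noteq> G"
  shows "filter_less F G \<longleftrightarrow> \<not> filter_less G F"
proof -
  obtain a where "a \<in> F \<and> a \<notin> G \<or> a \<in> G \<and> a \<notin> F" using \<open>F \<noteq> G\<close> by blast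
  then show ?thesis using filter_less_iff_left filter_less_iff_right assms by metis
qed

lemma filter_less_irrefl: "\<not> filter_less F F"
  by (auto simp: filter_less_def)

text \<open>
  Since \<open>a\<close> is left of \<open>G\<close> and right of \<open>H\<close>, an element of \<open>G\<close> outside \<open>H\<close> would have to be both to
  the right of \<open>a\<close>, because \<open>a\<close> is left of \<open>G\<close>, and to the left of \<open>a\<close>, because \<open>H\<close> separates
  the two.  Likewise for an element of \<open>H\<close> outside \<open>G\<close>, with the directions exchanged.
\<close>

lemma filter_less_no_cycle:
  assumes F: "semi_prime_filter F" and G: "semi_prime_filter G" and H: "semi_prime_filter H"
    and less: "filter_less F G" "filter_less G H" "filter_less H F" and a: "a \<in> F" "a \<notin> G"
  shows False
proof -
  have nz: "x \<noteq> bot" if "x \<in> K" "semi_prime_filter K" for x and K :: "'a set"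
    using that bot_notin_filter by metis
  have Ga: "left G a" using filter_less_iff_left[OF F G a] less by blast
  then have aH: "a \<notin> H" using filter_less_iff_right[OF G H _ a(2)] less by blast
  have Ha: "\<not> left H a" using filter_less_iff_right[OF H F a(1) aH] less by blast
  show False
  proof (cases "\<exists>c. c \<in> G \<and> c \<notin> H")
    case True
    then obtain c where c: "c \<in> G" "c \<notin> H" by blast
    have "left H c" using filter_less_iff_left[OF G H c] less by blast
    from left_right_before[OF H c(2) aH nz[OF c(1) G] nz[OF a(1) F] this Ha]
    have "incomparable c a" "before c a" .
    then show False
      using left_iff_before[OF G a(2) c(1)] Ga before_asym[of c a] by (simp add: incomparable_sym)
  next
    case False
    then obtain e where e: "e \<in> H" "e \<notin> G" using less(2) filter_less_irrefl by (metis subsetI subset_antisym)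
    have "\<not> left G e" using filter_less_iff_right[OF G H e] less by blast
    from left_right_before[OF G a(2) e(2) nz[OF a(1) F] nz[OF e(1) H] Ga this]
    show False using left_iff_before[OF H aH e(1)] Ha by blast
  qed
qed

lemma filter_less_trans:
  assumes "semi_prime_filter F" "semi_prime_filter G" "semi_prime_filter H"
    and "filter_less F G" "filter_less G H"
  shows "filter_less F H"
proof (rule ccontr)
  assume n: "\<not> filter_less F H"
  have "F \<noteq> H" using filter_less_asym[of F G] filter_less_irrefl assms by metis
  then have less: "filter_less H F" using filter_less_asym[of F H] n assms by blast
  \<comment> \<open>Each failing inclusion would start one of the three rotations of the same cycle.\<close>
  have "F \<subseteq> G" "G \<subseteq> H" "H \<subseteq> F"
    using filter_less_no_cycle[of F G H] filter_less_no_cycle[of G H F]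
      filter_less_no_cycle[of H F G] assms less by blast+
  then show False using \<open>F \<noteq> H\<close> by blast
qed

text \<open>
  Convexity and hulls follow from the fact that any \<open>a\<close> outside \<open>F\<close> places all the points of \<open>a\<close>
  on one side of \<open>F\<close>.  If \<open>F\<close> contains \<open>sup a b\<close> only, then \<open>a\<close> and \<open>b\<close> are on opposite sides, and a
  point of \<open>a\<close> and a point of \<open>b\<close> enclose \<open>F\<close>.
\<close>

theorem faithful_representation_by_filters:
  "faithful_interval_representation {F. semi_prime_filter F}
     {(F, G). semi_prime_filter F \<and> semi_prime_filter G \<and> (F = G \<or> filter_less F G)}
     (\<lambda>a. {F. semi_prime_filter F \<and> a \<in> F})"
  (is "faithful_interval_representation ?X ?r ?f")
proof -
  have lin: "linear_order_on ?X ?r"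
    unfolding order_on_defs
  proof (intro conjI)
    show "refl_on ?X ?r" by (auto simp: refl_on_def)
    show "trans ?r" by (rule transI) (auto dest: filter_less_trans)
    show "antisym ?r" by (rule antisymI) (use filter_less_asym in blast)
    show "total_on ?X ?r" by (rule total_onI) (use filter_less_asym in blast)
  qed auto
  have interval: "order_interval ?X ?r (?f a)" for a
    unfolding order_interval_def
  proof (intro conjI ballI impI)
    fix F H G assume "F \<in> ?f a" "H \<in> ?f a" "G \<in> ?X" "(F, G) \<in> ?r \<and> (G, H) \<in> ?r"
    then show "G \<in> ?f a"
      using filter_less_iff_left[of F G a] filter_less_iff_right[of G H a] by auto
  qed auto
  have embedding: "a \<le> b \<longleftrightarrow> ?f a \<subseteq> ?f b" for a b
  proof
    show "a \<le> b \<Longrightarrow> ?f a \<subseteq> ?f b" using filter_up by blast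
    assume "?f a \<subseteq> ?f b"
    then show "a \<le> b" using semi_prime_separation[of a b] by blast
  qed
  have rep: "interval_representation ?X ?r ?f"
    unfolding interval_representation_def
  proof (intro conjI allI)
    show "?f bot = {}" using bot_notin_filter by auto
    show "?f (inf a b) = ?f a \<inter> ?f b" for a b
      using filter_inf filter_up by (auto intro: inf_le1 inf_le2)
  qed (fact lin interval embedding)+
  show ?thesis
    unfolding faithful_interval_representation_def
  proof (intro conjI allI rep)
    fix a b
    have hull: "order_interval ?X ?r hull (?f a \<union> ?f b) =
        {F \<in> ?X. \<exists>G\<in>?f a \<union> ?f b. \<exists>H\<in>?f a \<union> ?f b. (G, F) \<in> ?r \<and> (F, H) \<in> ?r}"
      by (rule order_interval_hull_eq[OF lin]) auto
    show "?f (sup a b) = order_interval ?X ?r hull (?f a \<union> ?f b)"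
    proof (intro subset_antisym subsetI)
      fix F assume "F \<in> ?f (sup a b)"
      then have F: "semi_prime_filter F" "sup a b \<in> F" by auto
      show "F \<in> order_interval ?X ?r hull (?f a \<union> ?f b)"
      proof (cases "a \<in> F \<or> b \<in> F")
        case True
        then show ?thesis using F hull_subset[of "?f a \<union> ?f b"] by blast
      next
        case False
        then have nz: "a \<noteq> bot" "b \<noteq> bot" using F by auto
        obtain A B where AB: "semi_prime_filter A" "a \<in> A" "semi_prime_filter B" "b \<in> B"
          using nz by (metis bot.extremum_uniqueI semi_prime_separation)
        have "left F a \<noteq> left F b" using left_eq_iff[OF F(1) _ _ nz] False F by blast
        then have "filter_less A F \<and> filter_less F B \<or> filter_less B F \<and> filter_less F A"
          using filter_less_iff_left filter_less_iff_right AB F False by metis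
        then show ?thesis unfolding hull using AB F by blast
      qed
    next
      have "order_interval ?X ?r hull (?f a \<union> ?f b) \<subseteq> ?f (sup a b)"
        using embedding[of a "sup a b"] embedding[of b "sup a b"]
        by (intro hull_minimal interval Un_least) simp_all
      then show "F \<in> ?f (sup a b)" if "F \<in> order_interval ?X ?r hull (?f a \<union> ?f b)" for F
        using that by blast
    qed
  qed
qed

end

section \<open>Lattices of intervals are loc-lattices\<close>

text \<open>
  A point outside an interval has the whole interval on one side (\<open>beyond\<close>, \<open>before\<close>).  For the first
  axiom, take for each of the three intervals a point outside the hull of the other two: it is
  below or above both of them, and two of the three points are extreme in the same direction, hence
  each beyond the other.  For the second, a point \<open>p\<close> outside \<open>x\<close>, say above it, but in both hulls
  has points of both \<open>a\<close> and \<open>b\<close> above it.  Then \<open>a\<close> lies above a point of \<open>x\<close>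
  outside \<open>a\<close>, and similarly for \<open>b\<close>; the lower one of these two points is not in the hull of
  \<open>a\<close> and \<open>b\<close>.  For the third, a point of \<open>x\<close> outside \<open>a\<close> and \<open>b\<close> separates \<open>a\<close> from \<open>b\<close>, hence also
  their parts inside \<open>x\<close>.
\<close>

lemma faithfully_representable_loc_lattice:
  assumes "faithfully_representable TYPE('a::bounded_lattice_bot)"
  shows "loc_lattice TYPE('a)"
proof -
  obtain X :: "'a set set" and r and f :: "'a \<Rightarrow> 'a set set"
    where rep: "faithful_interval_representation X r f"
    using assms by (auto simp: faithfully_representable_def)
  then have lin: "linear_order_on X r" and int: "\<And>a. order_interval X r (f a)"
    and emb: "\<And>a b. a \<le> b \<longleftrightarrow> f a \<subseteq> f b" and bot: "f bot = {}"
    and meet: "\<And>a b. f (inf a b) = f a \<inter> f b"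
    and join: "\<And>a b. f (sup a b) = order_interval X r hull (f a \<union> f b)"
    by (auto simp: faithful_interval_representation_def interval_representation_def)
  have fX: "p \<in> X" if "p \<in> f a" for p a using int[of a] that by (auto simp: order_interval_def)
  have conv: "y \<in> f a" if "x \<in> f a" "z \<in> f a" "y \<in> X" "(x, y) \<in> r" "(y, z) \<in> r" for x y z a
    using int[of a] that unfolding order_interval_def by blast
  have tr: "(x, z) \<in> r" if "(x, y) \<in> r" "(y, z) \<in> r" for x y z
    using lin that by (auto simp: order_on_defs dest: transD)
  have tot: "(x, y) \<in> r \<or> (y, x) \<in> r" if "x \<in> X" "y \<in> X" for x y
    using lin that by (cases "x = y") (auto simp: order_on_defs refl_on_def total_on_def)
  have mem_join: "p \<in> f (sup a b) \<longleftrightarrow>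
      p \<in> X \<and> (\<exists>u\<in>f a \<union> f b. (u, p) \<in> r) \<and> (\<exists>v\<in>f a \<union> f b. (p, v) \<in> r)" for p a b
  proof -
    have "f a \<union> f b \<subseteq> X" using fX by blast
    from order_interval_hull_eq[OF lin this] show ?thesis unfolding join by blast
  qed
  have beyond: "(v, p) \<in> r \<and> (p, v) \<notin> r"
    if "p \<in> X" "p \<notin> f a" "u \<in> f a" "(u, p) \<in> r" "v \<in> f a" for p u v a
    using that conv tot fX by blast
  have before: "(p, v) \<in> r \<and> (v, p) \<notin> r"
    if "p \<in> X" "p \<notin> f a" "u \<in> f a" "(p, u) \<in> r" "v \<in> f a" for p u v a
    using that conv tot fX by blast
  have one: "b \<le> sup a c \<or> a \<le> sup b c \<or> c \<le> sup a b" for a b c :: 'a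
  proof (rule ccontr)
    assume "\<not> ?thesis"
    then obtain p q s where pqs: "p \<in> f b" "p \<notin> f (sup a c)" "q \<in> f a" "q \<notin> f (sup b c)"
        "s \<in> f c" "s \<notin> f (sup a b)"
      unfolding emb by blast
    then have X: "p \<in> X" "q \<in> X" "s \<in> X" using fX by blast+
    have "((q, p) \<notin> r \<and> (s, p) \<notin> r) \<or> ((p, q) \<notin> r \<and> (p, s) \<notin> r)"
      "((p, q) \<notin> r \<and> (s, q) \<notin> r) \<or> ((q, p) \<notin> r \<and> (q, s) \<notin> r)"
      "((p, s) \<notin> r \<and> (q, s) \<notin> r) \<or> ((s, p) \<notin> r \<and> (s, q) \<notin> r)"
      using pqs X unfolding mem_join by blast+
    then show False using tot X by blast
  qed
  have two: "inf (sup a x) (sup b x) = x"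
    if inc: "incomparable a x" "incomparable b x" and x: "x \<le> sup a b" for a b x :: 'a
  proof (rule order_antisym)
    have "p \<in> f x" if p: "p \<in> f (sup a x)" "p \<in> f (sup b x)" for p
    proof (rule ccontr)
      assume px: "p \<notin> f x"
      obtain x1 x2 where x12: "x1 \<in> f x" "x1 \<notin> f a" "x2 \<in> f x" "x2 \<notin> f b"
        using inc unfolding incomparable_def emb by blast
      have X: "p \<in> X" "x1 \<in> X" "x2 \<in> X" using fX p x12 by blast+
      have hx: "x1 \<in> f (sup a b)" "x2 \<in> f (sup a b)" using x x12 unfolding emb by blast+
      consider "(x1, p) \<in> r" | "(p, x1) \<in> r" using tot X by blast
      then show False
      proof cases
        case 1
        then have above: "(v, p) \<in> r \<and> (p, v) \<notin> r" if "v \<in> f x" for v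
          using beyond[OF X(1) px x12(1)] that by blast
        then obtain a0 b0 where ab: "a0 \<in> f a" "(p, a0) \<in> r" "b0 \<in> f b" "(p, b0) \<in> r"
          using p unfolding mem_join by blast
        then have "(x1, a0) \<in> r" "(x2, b0) \<in> r" using above x12 tr by blast+
        then have "(v, x1) \<notin> r" if "v \<in> f a" for v
          using before[OF X(2) x12(2) ab(1) _ that] by blast
        moreover have "(v, x2) \<notin> r" if "v \<in> f b" for v
          using before[OF X(3) x12(4) ab(3) \<open>(x2, b0) \<in> r\<close> that] by blast
        ultimately show False using hx tot[OF X(2,3)] tr unfolding mem_join by blast
      next
        case 2
        then have below: "(p, v) \<in> r \<and> (v, p) \<notin> r" if "v \<in> f x" for v
          using before[OF X(1) px x12(1)] that by blast
        then obtain a0 b0 where ab: "a0 \<in> f a" "(a0, p) \<in> r" "b0 \<in> f b" "(b0, p) \<in> r"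
          using p unfolding mem_join by blast
        then have "(a0, x1) \<in> r" "(b0, x2) \<in> r" using below x12 tr by blast+
        then have "(x1, v) \<notin> r" if "v \<in> f a" for v
          using beyond[OF X(2) x12(2) ab(1) _ that] by blast
        moreover have "(x2, v) \<notin> r" if "v \<in> f b" for v
          using beyond[OF X(3) x12(4) ab(3) \<open>(b0, x2) \<in> r\<close> that] by blast
        ultimately show False using hx tot[OF X(2,3)] tr unfolding mem_join by blast
      qed
    qed
    then show "inf (sup a x) (sup b x) \<le> x" unfolding emb meet by blast
  qed simp
  have three: "sup (inf a x) (inf b x) = x"
    if x: "x \<le> sup a b" and nz: "inf a x \<noteq> bot" "inf b x \<noteq> bot" for a b x :: 'a
  proof (rule order_antisym)
    have ne: "f (inf a x) \<noteq> {}" "f (inf b x) \<noteq> {}"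
      using nz emb[of _ bot] bot by (auto simp: bot_unique)
    then obtain u v where uv: "u \<in> f a" "u \<in> f x" "v \<in> f b" "v \<in> f x" unfolding meet by blast
    have "p \<in> f (sup (inf a x) (inf b x))" if p: "p \<in> f x" for p
    proof (cases "p \<in> f a \<or> p \<in> f b")
      case True
      have "(p, p) \<in> r" using tot fX p by blast
      then show ?thesis unfolding mem_join meet using True p fX by blast
    next
      case False
      have "p \<in> f (sup a b)" using p x emb by blast
      then have "((u, p) \<in> r \<and> (p, v) \<in> r) \<or> ((v, p) \<in> r \<and> (p, u) \<in> r)"
        using False uv beyond[of p a] beyond[of p b] before[of p a] before[of p b]
        unfolding mem_join by blast
      then show ?thesis unfolding mem_join meet using uv p fX by blast
    qed
    then show "x \<le> sup (inf a x) (inf b x)" unfolding emb by blast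
  qed simp
  show ?thesis unfolding loc_lattice_def using one two three by blast
qed

section \<open>The representation theorem\<close>

lemma loc_lattice_faithfully_representable:
  assumes "loc_lattice TYPE('a::bounded_lattice_bot)"
  shows "faithfully_representable TYPE('a)"
proof -
  obtain before :: "'a \<Rightarrow> 'a \<Rightarrow> bool"
    where "\<And>a b. incomparable a b \<Longrightarrow> before a b \<longleftrightarrow> \<not> before b a"
    and "\<And>a b c. incomparable a b \<Longrightarrow> incomparable b c \<Longrightarrow>
      b \<le> sup a c \<longleftrightarrow> (before a b \<longleftrightarrow> before b c)"
    using loc_lattice_orientation[OF assms] by blast
  then interpret oriented_loc_lattice before
    using assms by unfold_locales
  show ?thesis using faithful_representation_by_filters by (rule faithfully_representableI)
qed

theorem theorem1p3:
  shows "(loc_lattice TYPE('a::bounded_lattice_bot) \<longrightarrow> representable TYPE('a)) \<and>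
    (well_separated TYPE('a) \<longrightarrow>
       (faithfully_representable TYPE('a) \<longleftrightarrow> loc_lattice TYPE('a)))"
proof -
  have "representable TYPE('a)" if "faithfully_representable TYPE('a)"
    using that unfolding faithfully_representable_def representable_def
      faithful_interval_representation_def by blast
  then show ?thesis
    using loc_lattice_faithfully_representable faithfully_representable_loc_lattice by blast
qed

end
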